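(* Let $x>1$ be a constant. For every instance of the Bamboo Garden Trimming problem (every $n\ge1$ and all growth rates $h_1\ge\dots\ge h_n>0$ with $\sum_{i=1}^n h_i=1$), the makespan of the strategy Reduce-Fastest$(x)$ is at most $$\max\left\{x+\frac{x^2}{4(x-1)},\ \frac12+x+\frac{x^2}{4\left(x-\frac12\right)}\right\}.$$
   Context: Bamboo Garden Trimming (BGT) problem: a garden contains $n$ bamboos $b_1,\dots,b_n$; bamboo $b_i$ has daily growth rate $h_i>0$, with $h_1\ge\dots\ge h_n$ and $\sum_{i=1}^n h_i=1$. Initially all heights are $0$. Days are numbered $1,2,3,\dots$. At the end of each day at most one bamboo is trimmed, which instantaneously resets its height to $0$. The height of $b_i$ at the end of day $d\ge1$, before the trimming decision of that day, is $(d-d')h_i$, where $d'<d$ is the last day preceding $d$ in which $b_i$ was trimmed ($d'=0$ if $b_i$ was never trimmed before day $d$). A perpetual schedule specifies which bamboo (if any) is trimmed at the end of each day. The makespan of a schedule is the maximum height (measured at the end of a day, before trimming) ever reached by any bamboo over all days. Reduce-Fastest$(x)$: at the end of each day, trim the bamboo with the fastest daily growth rate among those whose height is at least $x$ (ties are broken in favour of the bamboo with the smallest index); if no bamboo has height at least $x$, no bamboo is trimmed that day. *)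

theory Defs
  imports "HOL-Analysis.Analysis"
begin

definition bgt_instance :: "nat \<Rightarrow> (nat \<Rightarrow> real) \<Rightarrow> bool" where
  "bgt_instance n h \<longleftrightarrow>
     1 \<le> n \<and> (\<forall>i\<in>{1..n}. 0 < h i) \<and>
     (\<forall>i\<in>{1..n}. \<forall>j\<in>{1..n}. i \<le> j \<longrightarrow> h j \<le> h i) \<and>
     (\<Sum>i=1..n. h i) = 1"

text \<open>
  A schedule maps each day to the index of the bamboo trimmed at the end of that day,
  or to \<open>None\<close>. Days start at 1; the value of a schedule at 0 is never inspected.
\<close>

type_synonym schedule = "nat \<Rightarrow> nat option"

definition last_trim :: "schedule \<Rightarrow> nat \<Rightarrow> nat \<Rightarrow> nat" where
  "last_trim s i d = Max (insert 0 {d'. 1 \<le> d' \<and> d' < d \<and> s d' = Some i})"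

definition height :: "(nat \<Rightarrow> real) \<Rightarrow> schedule \<Rightarrow> nat \<Rightarrow> nat \<Rightarrow> real" where
  "height h s i d = (real d - real (last_trim s i d)) * h i"

text \<open>
  The supremum is taken in the extended reals, so that a schedule with unbounded heights
  has makespan \<open>\<infinity>\<close>.
\<close>

definition makespan :: "nat \<Rightarrow> (nat \<Rightarrow> real) \<Rightarrow> schedule \<Rightarrow> ereal" where
  "makespan n h s = (SUP d\<in>{1..}. SUP i\<in>{1..n}. ereal (height h s i d))"

definition reduce_fastest_choice ::
    "real \<Rightarrow> nat \<Rightarrow> (nat \<Rightarrow> real) \<Rightarrow> (nat \<Rightarrow> real) \<Rightarrow> nat option" where
  "reduce_fastest_choice x n h H =
     (let A = {i\<in>{1..n}. x \<le> H i}
      in if A = {} then None else Some (Min {i\<in>A. \<forall>j\<in>A. h j \<le> h i}))"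

text \<open>
  The height on day \<open>d\<close> depends only on the trims of earlier days; this makes the
  recursion defining the schedule of Reduce-Fastest below well-founded.
\<close>

lemma height_cong [fundef_cong]:
  assumes "h = h'" "i = i'" "d = d'" "\<And>e. e < d' \<Longrightarrow> s e = s' e"
  shows "height h s i d = height h' s' i' d'"
proof -
  have "{e. 1 \<le> e \<and> e < d' \<and> s e = Some i'} = {e. 1 \<le> e \<and> e < d' \<and> s' e = Some i'}"
    using assms(4) by auto
  then show ?thesis
    using assms(1-3) by (simp add: height_def last_trim_def)
qed

function reduce_fastest :: "real \<Rightarrow> nat \<Rightarrow> (nat \<Rightarrow> real) \<Rightarrow> schedule" where
  "reduce_fastest x n h d =
     reduce_fastest_choice x n h (\<lambda>i. height h (\<lambda>e. reduce_fastest x n h e) i d)"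
  by pat_completeness auto
termination
  by (relation "Wellfounded.measure (\<lambda>(x, n, h, d). d)") auto

declare reduce_fastest.simps [simp del]

end

theory Submission
  imports Defs
begin

text \<open>
  Suppose bamboo \<open>i\<close>, of rate \<open>\<rho>\<close>, exceeds \<open>x\<close> and is then left uncut for \<open>N\<close> further days.
  On each of those days a bamboo at least as fast as \<open>i\<close> is cut; let \<open>m\<close> be the number of
  different bamboos cut. Two cuts of bamboo \<open>j\<close> are at least \<open>x / h j\<close> days apart, so the number
  of its cuts is controlled by the distance between its first and its last cut. First cuts of
  different bamboos fall on different days, and so do last cuts; hence the time lost before first
  cuts and after last cuts is at least \<open>m (m - 1)\<close> in total, and
  \<open>N x \<le> m x + (N - 1) (1 - \<rho>) - \<rho> m (m - 1)\<close>. With \<open>m \<rho> (x - m \<rho>) \<le> x\<^sup>2 / 4\<close> and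
  \<open>m \<rho> \<le> 1 - \<rho>\<close> the excess height \<open>N \<rho>\<close> is at most \<open>x\<^sup>2 / (4 (x - 1 + \<rho>))\<close>. The resulting bound
  \<open>x + \<rho> + x\<^sup>2 / (4 (x - 1 + \<rho>))\<close> is convex in \<open>\<rho>\<close>, and \<open>0 \<le> \<rho> \<le> 1/2\<close> because some other bamboo is
  at least as fast.
\<close>

section \<open>Counting distinct days and spaced cuts\<close>

text \<open>Each new maximum \<open>b\<close> is at least the number of smaller elements, so the sum
  is at least \<open>0 + 1 + ... + (card A - 1)\<close>.\<close>

lemma card_times_pred_le_twice_sum:
  assumes "finite (A :: nat set)"
  shows "real (card A) * (real (card A) - 1) \<le> 2 * (\<Sum>a\<in>A. real a)"
  using assms
proof (induction A rule: finite_linorder_max_induct)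
  case empty
  then show ?case by simp
next
  case (insert b A)
  have "card A \<le> b"
    using card_mono[of "{..<b}" A] insert.hyps by auto
  moreover have "b \<notin> A"
    using insert.hyps by auto
  ultimately show ?case
    using insert by (simp add: algebra_simps)
qed

lemma card_times_pred_le_twice_sum_inj:
  fixes f :: "'a \<Rightarrow> nat"
  assumes "finite J" "inj_on f J"
  shows "real (card J) * (real (card J) - 1) \<le> 2 * (\<Sum>j\<in>J. real (f j))"
  using card_times_pred_le_twice_sum[of "f ` J"] assms
  by (simp add: sum.reindex card_image)

text \<open>The \<open>card A - 1\<close> gaps between consecutive elements telescope to
  \<open>Max A - Min A\<close>.\<close>

lemma spaced_card_bound:
  fixes A :: "nat set" and x r :: real
  assumes "finite A" "A \<noteq> {}"
    and "\<And>e e'. e \<in> A \<Longrightarrow> e' \<in> A \<Longrightarrow> e < e' \<Longrightarrow> x \<le> (real e' - real e) * r"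
  shows "(real (card A) - 1) * x \<le> (real (Max A) - real (Min A)) * r"
  using assms
proof (induction A rule: finite_linorder_max_induct)
  case empty
  then show ?case by simp
next
  case (insert b A)
  show ?case
  proof (cases "A = {}")
    case True
    then show ?thesis by simp
  next
    case False
    have "Max A \<in> A"
      using False insert.hyps by simp
    moreover from this have lt: "Max A < b"
      using insert.hyps by blast
    ultimately have "x \<le> (real b - real (Max A)) * r"
      using insert.prems by blast
    moreover have "(real (card A) - 1) * x \<le> (real (Max A) - real (Min A)) * r"
      using insert False by blast
    moreover have "Max (insert b A) = b"
      using lt False insert.hyps by simp
    moreover have "Min (insert b A) = Min A"
      using False insert.hyps less_imp_le[of "Min A" b] by (simp add: min_absorb2)
    moreover have "b \<notin> A"
      using insert.hyps by auto
    ultimately show ?thesis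
      using insert.hyps by (simp add: algebra_simps)
  qed
qed

text \<open>Here \<open>c e\<close> is the bamboo cut on day \<open>e\<close> and \<open>r\<close>
  gives the rates. The spacing bound is summed over all bamboos cut; the waits before first cuts and
  after last cuts produce the term quadratic in \<open>m\<close>.\<close>

lemma cut_count_bound:
  fixes c :: "nat \<Rightarrow> 'a" and r :: "'a \<Rightarrow> real"
  assumes "a < b" "0 \<le> \<rho>"
    and spaced: "\<And>e e'. e \<in> {a..<b} \<Longrightarrow> e' \<in> {a..<b} \<Longrightarrow> e < e' \<Longrightarrow> c e = c e' \<Longrightarrow>
      x \<le> (real e' - real e) * r (c e)"
    and fast: "\<And>j. j \<in> c ` {a..<b} \<Longrightarrow> \<rho> \<le> r j"
  defines "N \<equiv> real b - real a" and "m \<equiv> real (card (c ` {a..<b}))"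
  shows "N * x \<le> m * x + (N - 1) * (\<Sum>j\<in>c ` {a..<b}. r j) - \<rho> * m * (m - 1)"
proof -
  define W where "W = {a..<b}"
  define J where "J = c ` W"
  define D where "D j = {e \<in> W. c e = j}" for j
  define f where "f j = Min (D j)" for j
  define l where "l j = Max (D j)" for j
  have fin: "finite W" "finite J" "finite (D j)" for j
    by (auto simp: W_def J_def D_def)
  have ne: "D j \<noteq> {}" if "j \<in> J" for j
    using that by (auto simp: J_def D_def)
  have f: "f j \<in> W" "c (f j) = j" if "j \<in> J" for j
    using Min_in[OF fin(3) ne[OF that]] by (auto simp: f_def D_def)
  have l: "l j \<in> W" "c (l j) = j" if "j \<in> J" for j
    using Max_in[OF fin(3) ne[OF that]] by (auto simp: l_def D_def)
  have N: "N = (\<Sum>j\<in>J. real (card (D j)))"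
  proof -
    have "(\<Sum>j\<in>J. \<Sum>e\<in>{e \<in> W. c e = j}. 1) = (\<Sum>e\<in>W. 1 :: real)"
      by (rule sum.group) (use fin in \<open>auto simp: J_def\<close>)
    then show ?thesis
      using \<open>a < b\<close> by (simp add: D_def N_def W_def of_nat_diff)
  qed
  \<comment> \<open>\<open>c\<close> recovers \<open>j\<close> from \<open>f j\<close> and from
    \<open>l j\<close>; both days lie in \<open>W\<close>, so the natural subtractions do not
    truncate.\<close>
  have inj: "inj_on (\<lambda>j. f j - a) J" "inj_on (\<lambda>j. b - 1 - l j) J"
  proof -
    show "inj_on (\<lambda>j. f j - a) J"
    proof (rule inj_onI)
      fix j k assume jk: "j \<in> J" "k \<in> J" "f j - a = f k - a"
      then have "f j = f k" using f(1)[of j] f(1)[of k] by (auto simp: W_def)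
      then show "j = k" using f(2) jk by metis
    qed
    show "inj_on (\<lambda>j. b - 1 - l j) J"
    proof (rule inj_onI)
      fix j k assume jk: "j \<in> J" "k \<in> J" "b - 1 - l j = b - 1 - l k"
      then have "l j = l k" using l(1)[of j] l(1)[of k] by (auto simp: W_def)
      then show "j = k" using l(2) jk by metis
    qed
  qed
  have lost: "(\<Sum>j\<in>J. (real (card (D j)) - 1) * x)
      \<le> (\<Sum>j\<in>J. (N - 1) * r j - \<rho> * (real (f j - a) + real (b - 1 - l j)))"
  proof (rule sum_mono)
    fix j assume j: "j \<in> J"
    have "(real (card (D j)) - 1) * x \<le> (real (l j) - real (f j)) * r j"
      unfolding l_def f_def
    proof (rule spaced_card_bound[OF fin(3) ne[OF j]])
      fix e e' assume "e \<in> D j" "e' \<in> D j" "e < e'"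
      then show "x \<le> (real e' - real e) * r j"
        using spaced[of e e'] by (simp add: D_def W_def)
    qed
    \<comment> \<open>The span from first to last cut is the full span \<open>N - 1\<close> minus
      the two waits.\<close>
    also have "\<dots> = (N - 1) * r j - r j * (real (f j - a) + real (b - 1 - l j))"
      using f(1)[OF j] l(1)[OF j] by (simp add: W_def N_def of_nat_diff algebra_simps)
    also have "\<dots> \<le> (N - 1) * r j - \<rho> * (real (f j - a) + real (b - 1 - l j))"
      using fast[of j] j by (intro diff_left_mono mult_right_mono) (auto simp: J_def W_def)
    finally show "(real (card (D j)) - 1) * x
      \<le> (N - 1) * r j - \<rho> * (real (f j - a) + real (b - 1 - l j))" .
  qed
  have m: "m = real (card J)"
    by (simp add: m_def J_def W_def)
  \<comment> \<open>Each of the two sums of waits contributes half of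
    \<open>m * (m - 1)\<close>.\<close>
  have "m * (m - 1) \<le> (\<Sum>j\<in>J. real (f j - a)) + (\<Sum>j\<in>J. real (b - 1 - l j))"
    using card_times_pred_le_twice_sum_inj[OF fin(2) inj(1)]
      card_times_pred_le_twice_sum_inj[OF fin(2) inj(2)] unfolding m by linarith
  then have "\<rho> * (m * (m - 1)) \<le> \<rho> * (\<Sum>j\<in>J. real (f j - a) + real (b - 1 - l j))"
    using \<open>0 \<le> \<rho>\<close> by (intro mult_left_mono) (simp_all add: sum.distrib)
  moreover have "(\<Sum>j\<in>J. (real (card (D j)) - 1) * x) = N * x - m * x"
    unfolding N m by (simp add: sum_distrib_left sum_subtractf algebra_simps)
  moreover have "(\<Sum>j\<in>J. (N - 1) * r j - \<rho> * (real (f j - a) + real (b - 1 - l j)))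
      = (N - 1) * (\<Sum>j\<in>J. r j) - \<rho> * (\<Sum>j\<in>J. real (f j - a) + real (b - 1 - l j))"
    by (simp only: sum_subtractf sum_distrib_left)
  ultimately show ?thesis
    using lost unfolding J_def W_def by linarith
qed

section \<open>Inequalities between reals\<close>

text \<open>With the denominator cleared, the claim reads
  \<open>q \<le> (M - \<rho>) * (u + \<rho>)\<close>. The right side is concave in \<rho>, so the
  cases 0 and 1/2 imply those in between.\<close>

lemma convex_bound_by_endpoints:
  fixes x \<rho> :: real
  assumes "1 < x" "0 \<le> \<rho>" "\<rho> \<le> 1/2"
  shows "\<rho> + x\<^sup>2 / (4 * (x - 1 + \<rho>))
    \<le> max (x\<^sup>2 / (4 * (x - 1))) (1/2 + x\<^sup>2 / (4 * (x - 1/2)))"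
proof -
  define u where "u = x - 1"
  define q where "q = x\<^sup>2 / 4"
  define M where "M = max (q / u) (1/2 + q / (u + 1/2))"
  have u: "0 < u" using assms by (simp add: u_def)
  have "q / u \<le> M" "1/2 + q / (u + 1/2) \<le> M"
    by (simp_all add: M_def)
  then have ends: "q \<le> M * u" "q \<le> (M - 1/2) * (u + 1/2)"
    using u by (simp_all add: field_simps)
  have "q \<le> (M - \<rho>) * (u + \<rho>)"
  proof -
    have "(1 - 2 * \<rho>) * q \<le> (1 - 2 * \<rho>) * (M * u)"
      "2 * \<rho> * q \<le> 2 * \<rho> * ((M - 1/2) * (u + 1/2))"
      using ends assms by (intro mult_left_mono; simp)+
    \<comment> \<open>This is the surplus of the concave product over linear interpolation between
      the endpoints.\<close>
    moreover have "0 \<le> \<rho> * (1/2 - \<rho>)"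
      using assms by simp
    moreover have "(M - \<rho>) * (u + \<rho>) = (1 - 2 * \<rho>) * (M * u)
        + 2 * \<rho> * ((M - 1/2) * (u + 1/2)) + \<rho> * (1/2 - \<rho>)"
      by (simp add: algebra_simps)
    moreover have "q = (1 - 2 * \<rho>) * q + 2 * \<rho> * q"
      by (simp add: algebra_simps)
    ultimately show ?thesis
      by linarith
  qed
  then have "q / (u + \<rho>) \<le> M - \<rho>"
    using u assms by (simp add: pos_divide_le_eq)
  then have "\<rho> + q / (u + \<rho>) \<le> M"
    by simp
  then show ?thesis
    by (simp add: M_def q_def u_def)
qed

text \<open>Multiply by \<rho> and put \<open>p = \<rho> * m\<close>: the main term
  \<open>p * (x - p)\<close> is at most a quarter of the square of \<open>x\<close>, and the
  leftover \<open>\<rho> * p\<close> is absorbed by \<open>\<rho> * (1 - \<rho>)\<close>.\<close>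

lemma excess_bound:
  fixes x \<rho> m N :: real
  assumes "1 < x" "0 \<le> \<rho>" "\<rho> * m \<le> 1 - \<rho>"
    and "N * x \<le> m * x + (N - 1) * (1 - \<rho>) - \<rho> * m * (m - 1)"
  shows "N * \<rho> \<le> x\<^sup>2 / (4 * (x - 1 + \<rho>))"
proof -
  have "\<rho> * (N * x) \<le> \<rho> * (m * x + (N - 1) * (1 - \<rho>) - \<rho> * m * (m - 1))"
    using assms by (intro mult_left_mono) auto
  moreover have "\<rho> * (\<rho> * m) \<le> \<rho> * (1 - \<rho>)"
    using assms by (intro mult_left_mono) auto
  moreover have "0 \<le> (x - 2 * (\<rho> * m))\<^sup>2"
    by simp
  ultimately have "N * \<rho> * (4 * (x - 1 + \<rho>)) \<le> x\<^sup>2"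
    by (simp add: power2_eq_square algebra_simps)
  then show ?thesis
    using assms by (simp add: pos_le_divide_eq)
qed

section \<open>Last trims and the greedy choice\<close>

lemma last_trim_bounds:
  assumes "1 \<le> d"
  shows "last_trim s i d < d"
    and "\<And>e. last_trim s i d < e \<Longrightarrow> e < d \<Longrightarrow> s e \<noteq> Some i"
proof -
  let ?A = "insert 0 {d'. 1 \<le> d' \<and> d' < d \<and> s d' = Some i}"
  have fin: "finite ?A" by simp
  have "Max ?A \<in> ?A" by (rule Max_in[OF fin]) simp
  then show "last_trim s i d < d"
    using assms by (auto simp: last_trim_def)
  show "s e \<noteq> Some i" if "last_trim s i d < e" "e < d" for e
  proof
    assume "s e = Some i"
    then have "e \<in> ?A" using that by auto
    then have "e \<le> last_trim s i d" unfolding last_trim_def by (rule Max_ge[OF fin])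
    then show False using that by simp
  qed
qed

lemma last_trim_ge:
  assumes "1 \<le> e" "e < d" "s e = Some i"
  shows "e \<le> last_trim s i d"
  using last_trim_bounds(2)[of d s i e] assms by (metis leI less_imp_le order_le_less_trans)

text \<open>No cut of \<open>i\<close> falls strictly between its last trim and \<open>d\<close>;
  hence its height is linear in the day on that stretch.\<close>

lemma last_trim_eq:
  assumes "last_trim s i d < e" "e \<le> d"
  shows "last_trim s i e = last_trim s i d"
proof -
  have "s e' \<noteq> Some i" if "e \<le> e'" "e' < d" for e'
    using last_trim_bounds(2)[of d s i e'] that assms by auto
  then have "{d'. 1 \<le> d' \<and> d' < e \<and> s d' = Some i} = {d'. 1 \<le> d' \<and> d' < d \<and> s d' = Some i}"
    using assms(2) by (intro Collect_cong) (metis leI order.strict_trans2)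
  then show ?thesis
    by (simp add: last_trim_def)
qed

lemma reduce_fastest_trims_faster:
  assumes "i \<in> {1..n}" "x \<le> height h (reduce_fastest x n h) i d"
  obtains j where "reduce_fastest x n h d = Some j" "j \<in> {1..n}" "h i \<le> h j"
    "x \<le> height h (reduce_fastest x n h) j d"
proof -
  let ?H = "\<lambda>i. height h (reduce_fastest x n h) i d"
  define A where "A = {i \<in> {1..n}. x \<le> ?H i}"
  define B where "B = {i \<in> A. \<forall>j\<in>A. h j \<le> h i}"
  have i: "i \<in> A" using assms by (simp add: A_def)
  have fin: "finite A" "finite B" by (simp_all add: A_def B_def)
  \<comment> \<open>Finiteness yields a fastest eligible bamboo, so \<open>B\<close> is nonempty and
    \<open>Min B\<close> really belongs to it.\<close>
  obtain k where "k \<in> A" "h k = Max (h ` A)"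
    using Max_in[of "h ` A"] fin i by fastforce
  then have "k \<in> B" using fin by (simp add: B_def)
  then have B: "Min B \<in> B" using fin Min_in by blast
  have "reduce_fastest x n h d = Some (Min B)"
    using i by (subst reduce_fastest.simps) (auto simp: reduce_fastest_choice_def Let_def A_def B_def)
  with B i show ?thesis
    using that[of "Min B"] by (auto simp: B_def A_def)
qed

section \<open>The height bound for a single bamboo and day\<close>

text \<open>The height is split at \<open>a\<close>, the first day since the last cut on which it
  reaches \<open>x\<close>: growth up to \<open>a\<close> overshoots \<open>x\<close> by at most one
  day, and growth after \<open>a\<close> is the excess.\<close>

lemma reduce_fastest_height_le:
  assumes x: "1 < x" and inst: "bgt_instance n h" and d: "1 \<le> d" and i: "i \<in> {1..n}"
  shows "height h (reduce_fastest x n h) i d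
    \<le> x + max (x\<^sup>2 / (4 * (x - 1))) (1/2 + x\<^sup>2 / (4 * (x - 1/2)))"
    (is "_ \<le> x + ?M")
proof -
  define s where "s = reduce_fastest x n h"
  define L where "L = last_trim s i d"
  have pos: "0 < h j" if "j \<in> {1..n}" for j
    using inst that by (auto simp: bgt_instance_def)
  have sum1: "(\<Sum>j\<in>{1..n}. h j) = 1"
    using inst by (simp add: bgt_instance_def)
  have sub: "h i + (\<Sum>j\<in>J. h j) \<le> 1" if "J \<subseteq> {1..n} - {i}" for J
  proof -
    have "(\<Sum>j\<in>insert i J. h j) \<le> (\<Sum>j\<in>{1..n}. h j)"
      using that i pos by (intro sum_mono2) (auto simp: less_imp_le)
    moreover have "finite J" "i \<notin> J"
      using that finite_subset by (blast, blast)
    ultimately show ?thesis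
      using sum1 by simp
  qed
  \<comment> \<open>This settles the case \<open>a = d\<close>, where the height is at most
    \<open>x + h i\<close> with \<open>h i \<le> 1\<close>.\<close>
  have M1: "1 \<le> ?M"
  proof -
    have "0 \<le> (x - 2)\<^sup>2" by simp
    then have "1 \<le> x\<^sup>2 / (4 * (x - 1))"
      using x by (simp add: pos_le_divide_eq power2_eq_square algebra_simps)
    then show ?thesis by simp
  qed
  have Ld: "L < d" unfolding L_def by (rule last_trim_bounds[OF d])
  have hgt: "height h s i e = (real e - real L) * h i" if "L < e" "e \<le> d" for e
    using last_trim_eq[of s i d e] that by (simp add: height_def L_def)
  show ?thesis
  proof (cases "x \<le> height h s i d")
    case False
    then show ?thesis using M1 by (simp add: s_def)
  next
    case True
    define a where "a = (LEAST e. L < e \<and> e \<le> d \<and> x \<le> height h s i e)"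
    have a: "L < a" "a \<le> d" "x \<le> height h s i a"
      using LeastI[of "\<lambda>e. L < e \<and> e \<le> d \<and> x \<le> height h s i e" d] Ld True
      by (auto simp: a_def)
    have first: "(real a - real L) * h i \<le> x + h i"
    proof (cases "L < a - 1")
      case True
      then have "height h s i (a - 1) < x"
        using not_less_Least[of "a - 1" "\<lambda>e. L < e \<and> e \<le> d \<and> x \<le> height h s i e"] a
        by (auto simp: a_def[symmetric])
      then have "(real (a - 1) - real L) * h i < x"
        using hgt[of "a - 1"] True a by simp
      moreover have "real (a - 1) = real a - 1"
        using a by (simp add: of_nat_diff)
      ultimately show ?thesis
        by (simp add: algebra_simps)
    \<comment> \<open>Here \<open>a\<close> is the day right after the cut, so the height on day
      \<open>a\<close> is just \<open>h i\<close>.\<close>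
    next
      case False
      then have "a = Suc L" using a by simp
      then show ?thesis using x by simp
    qed
    define c where "c e = the (s e)" for e
    have c: "s e = Some (c e)" "c e \<in> {1..n} - {i}" "h i \<le> h (c e)" "x \<le> height h s (c e) e"
      if "e \<in> {a..<d}" for e
    proof -
      have "(real a - real L) * h i \<le> (real e - real L) * h i"
        using that pos[OF i] by (intro mult_right_mono) auto
      then have "x \<le> height h s i e"
        using a hgt[of a] hgt[of e] that by simp
      then obtain j where j: "s e = Some j" "j \<in> {1..n}" "h i \<le> h j" "x \<le> height h s j e"
        using reduce_fastest_trims_faster[OF i] unfolding s_def by metis
      moreover have "s e \<noteq> Some i"
        using last_trim_bounds(2)[OF d, of s i e] a that by (auto simp: L_def)
      ultimately show "s e = Some (c e)" "c e \<in> {1..n} - {i}" "h i \<le> h (c e)"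
        "x \<le> height h s (c e) e"
        by (auto simp: c_def)
    qed
    define J where "J = c ` {a..<d}"
    define N where "N = real d - real a"
    define m where "m = real (card J)"
    have J: "J \<subseteq> {1..n} - {i}" "\<And>j. j \<in> J \<Longrightarrow> h i \<le> h j"
      using c(2,3) unfolding J_def by blast+
    have split: "height h s i d = (real a - real L) * h i + N * h i"
      using hgt[of d] Ld by (simp add: N_def algebra_simps)
    show ?thesis
    proof (cases "a < d")
      case False
      moreover have "h i \<le> 1" using sub[of "{}"] by simp
      ultimately show ?thesis
        using split first M1 a by (simp add: N_def s_def)
    next
      case True
      have N1: "1 \<le> N" using True by (simp add: N_def)
      have mh: "h i * m \<le> (\<Sum>j\<in>J. h j)"
        using sum_bounded_below[of J "h i" h] J(2) by (simp add: m_def mult.commute)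
      \<comment> \<open>Some other bamboo, at least as fast as \<open>i\<close>, is cut on day
        \<open>a\<close>; the two rates sum to at most 1.\<close>
      have "1 \<le> m"
        using True by (simp add: m_def J_def Suc_le_eq card_gt_0_iff)
      then have "h i \<le> h i * m"
        using pos[OF i] by simp
      then have half: "h i \<le> 1/2"
        using mh sub[OF J(1)] by linarith
      have "N * x \<le> m * x + (N - 1) * (\<Sum>j\<in>J. h j) - h i * m * (m - 1)"
        unfolding N_def m_def J_def
      proof (rule cut_count_bound[OF True])
        show "0 \<le> h i" using pos[OF i] by simp
        show "h i \<le> h j" if "j \<in> c ` {a..<d}" for j
          using c that by auto
        fix e e' assume e: "e \<in> {a..<d}" "e' \<in> {a..<d}" "e < e'" "c e = c e'"
        \<comment> \<open>The bamboo cut on day \<open>e'\<close> has grown for at most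
          \<open>e' - e\<close> days, yet has reached \<open>x\<close>.\<close>
        have "e \<le> last_trim s (c e) e'"
          using e a c(1)[of e] by (intro last_trim_ge) auto
        then have "(real e' - real (last_trim s (c e) e')) * h (c e)
            \<le> (real e' - real e) * h (c e)"
          using pos[of "c e"] c(2)[of e] e by (intro mult_right_mono) auto
        then show "x \<le> (real e' - real e) * h (c e)"
          using c(4)[of e'] e by (simp add: height_def)
      qed
      moreover have "(N - 1) * (\<Sum>j\<in>J. h j) \<le> (N - 1) * (1 - h i)"
        using sub[OF J(1)] N1 by (intro mult_left_mono) auto
      ultimately have "N * h i \<le> x\<^sup>2 / (4 * (x - 1 + h i))"
        using x pos[OF i] mh sub[OF J(1)] by (intro excess_bound[of x "h i" m N]) auto
      moreover have "h i + x\<^sup>2 / (4 * (x - 1 + h i)) \<le> ?M"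
        using convex_bound_by_endpoints[OF x _ half] pos[OF i] by simp
      ultimately show ?thesis
        using split first unfolding s_def by linarith
    qed
  qed
qed

theorem theorem2:
  fixes x :: real and n :: nat and h :: "nat \<Rightarrow> real"
  assumes "1 < x" and "bgt_instance n h"
  shows "makespan n h (reduce_fastest x n h) \<le>
    ereal (max (x + x\<^sup>2 / (4 * (x - 1))) (1/2 + x + x\<^sup>2 / (4 * (x - 1/2))))"
proof -
  have "max (x + x\<^sup>2 / (4 * (x - 1))) (1/2 + x + x\<^sup>2 / (4 * (x - 1/2)))
      = x + max (x\<^sup>2 / (4 * (x - 1))) (1/2 + x\<^sup>2 / (4 * (x - 1/2)))"
    by (simp add: max_add_distrib_right add_ac)
  then show ?thesis
    using reduce_fastest_height_le[OF assms] unfolding makespan_def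
    by (intro SUP_least) simp
qed

end
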